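(* Let $\tau$ be a two-qubit state on $AB$, written as $$\tau=\tfrac14\Big(I\otimes I+\sum_{i=1}^3 a_i\,\sigma_i\otimes I+\sum_{j=1}^3 b_j\, I\otimes\sigma_j+\sum_{i,j=1}^3 t_{ij}\,\sigma_i\otimes\sigma_j\Big),$$ with $\mathbf b=(b_1,b_2,b_3)$ and $T=[t_{ij}]$. If, for some classical channel $\Pi=\{p_{l|k}\}_{k,l\in\{0,1,2,3\}}$, noisy teleportation over $\tau$ with classical channel $\Pi$ simulates a qubit channel that is not a Pauli channel, then $\mathbf b\neq 0$ or $T$ is non-diagonal. In particular, such a $\tau$ cannot be the Choi matrix of a Pauli channel.
   Context: $(\sigma_0,\sigma_1,\sigma_2,\sigma_3)=(I,\sigma_x,\sigma_y,\sigma_z)$ are the Pauli matrices. A Pauli channel is a qubit channel of the form $\rho\mapsto\sum_{i=0}^3p_i\sigma_i\rho\sigma_i$ with $(p_i)$ a probability distribution. The Choi matrix of a qubit channel $\mathcal E$ is $\chi_{\mathcal E}=(\mathbb I\otimes\mathcal E)(|\Phi\rangle\langle\Phi|)$ with $|\Phi\rangle=\frac1{\sqrt2}(|00\rangle+|11\rangle)$. A classical channel is a family $p_{l|k}\ge0$ with $\sum_{l=0}^3p_{l|k}=1$ for every $k\in\{0,1,2,3\}$. Bell projectors: $E_0=|\Phi^+\rangle\langle\Phi^+|$, $E_1=|\Psi^+\rangle\langle\Psi^+|$, $E_2=|\Psi^-\rangle\langle\Psi^-|$, $E_3=|\Phi^-\rangle\langle\Phi^-|$, where $|\Phi^\pm\rangle=\frac1{\sqrt2}(|00\rangle\pm|11\rangle)$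 and $|\Psi^\pm\rangle=\frac1{\sqrt2}(|01\rangle\pm|10\rangle)$. Noisy teleportation over a two-qubit state $\tau=\tau_{AB}$ with classical channel $\Pi$: Alice holds the input qubit $C$ in state $\rho$ and qubit $A$, Bob holds qubit $B$. Alice performs the Bell measurement $\{E_k\}_{k=0}^3$ on $CA$; when the outcome is $k$, Bob applies $\sigma_l$ to $B$ with probability $p_{l|k}$. The simulated qubit channel is $$\rho\mapsto\sum_{k,l=0}^3 p_{l|k}\;\sigma_l\,\mathrm{Tr}_{CA}\big[(E_k)_{CA}(\rho_C\otimes\tau_{AB})\big]\,\sigma_l .$$ *)

theory Defs
  imports "HOL-Analysis.Analysis"
begin

text \<open>
  Operators on a finite-dimensional system with orthonormal basis indexed by a finite type
  \<open>'n\<close> are matrices of type \<open>complex^'n^'n\<close>, and composite systems are indexed by product types.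
  A qubit is indexed by the two-element type \<open>2\<close>, with \<open>0\<close> and \<open>1\<close> labelling its two basis kets.
\<close>

type_synonym 'n op = "complex^'n^'n"
type_synonym qubit_op = "2 op"
type_synonym two_qubit_op = "(2 \<times> 2) op"

definition adjoint_mat :: "'n::finite op \<Rightarrow> 'n op" where
  "adjoint_mat A = (\<chi> i j. cnj (A $ j $ i))"

definition quad_form :: "'n::finite op \<Rightarrow> complex^'n \<Rightarrow> complex" where
  "quad_form A v = (\<Sum>i\<in>UNIV. cnj (v $ i) * (A *v v) $ i)"

definition density_operator :: "'n::finite op \<Rightarrow> bool" where
  "density_operator A \<longleftrightarrow>
     adjoint_mat A = A \<and> (\<forall>v. 0 \<le> Re (quad_form A v)) \<and> trace A = 1"

definition tensor :: "'m::finite op \<Rightarrow> 'n::finite op \<Rightarrow> ('m \<times> 'n) op" (infixr "\<otimes>\<^sub>M" 75) where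
  "A \<otimes>\<^sub>M B = (\<chi> i j. A $ fst i $ fst j * B $ snd i $ snd j)"

definition projector :: "complex^'n::finite \<Rightarrow> 'n op" where
  "projector v = (\<chi> i j. v $ i * cnj (v $ j))"

definition partial_trace_fst :: "('m::finite \<times> 'n::finite) op \<Rightarrow> 'n op" where
  "partial_trace_fst M = (\<chi> i j. \<Sum>c\<in>UNIV. M $ (c, i) $ (c, j))"

text \<open>The identification of \<open>X \<otimes> (Y \<otimes> Z)\<close> with \<open>(X \<otimes> Y) \<otimes> Z\<close>.\<close>

definition reassoc :: "('l::finite \<times> 'm::finite \<times> 'n::finite) op \<Rightarrow> (('l \<times> 'm) \<times> 'n) op" where
  "reassoc M = (\<chi> i j. M $ (fst (fst i), snd (fst i), snd i) $ (fst (fst j), snd (fst j), snd j))"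

definition mat2 :: "complex \<Rightarrow> complex \<Rightarrow> complex \<Rightarrow> complex \<Rightarrow> qubit_op" where
  "mat2 p q r s =
     (\<chi> i j. if i = 0 then (if j = 0 then p else q) else (if j = 0 then r else s))"

text \<open>Only the indices \<open>0, \<dots>, 3\<close> are meaningful here and in \<open>bell_vec\<close>.\<close>

definition pauli :: "nat \<Rightarrow> qubit_op" ("\<sigma>") where
  "\<sigma> k = (if k = 0 then mat2 1 0 0 1
          else if k = 1 then mat2 0 1 1 0
          else if k = 2 then mat2 0 (- \<i>) \<i> 0
          else mat2 1 0 0 (- 1))"

definition ket2 :: "2 \<Rightarrow> 2 \<Rightarrow> complex^(2 \<times> 2)" where
  "ket2 i j = axis (i, j) 1"

text \<open>In this order: \<open>\<Phi>\<^sup>+\<close>, \<open>\<Psi>\<^sup>+\<close>, \<open>\<Psi>\<^sup>-\<close>, \<open>\<Phi>\<^sup>-\<close>.\<close>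

definition bell_vec :: "nat \<Rightarrow> complex^(2 \<times> 2)" where
  "bell_vec k = (1 / sqrt 2) *\<^sub>R
     (if k = 0 then ket2 0 0 + ket2 1 1
      else if k = 1 then ket2 0 1 + ket2 1 0
      else if k = 2 then ket2 0 1 - ket2 1 0
      else ket2 0 0 - ket2 1 1)"

definition bell_proj :: "nat \<Rightarrow> two_qubit_op" where
  "bell_proj k = projector (bell_vec k)"

text \<open>
  Qubit channels are represented by their action on all qubit operators, not just on states.
\<close>

definition pauli_map :: "(nat \<Rightarrow> real) \<Rightarrow> qubit_op \<Rightarrow> qubit_op" where
  "pauli_map p \<rho> = (\<Sum>i\<le>3. p i *\<^sub>R (\<sigma> i ** \<rho> ** \<sigma> i))"

definition pauli_channel :: "(qubit_op \<Rightarrow> qubit_op) \<Rightarrow> bool" where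
  "pauli_channel \<E> \<longleftrightarrow>
     (\<exists>p. (\<forall>i\<le>3. 0 \<le> p i) \<and> (\<Sum>i\<le>3. p i) = 1 \<and> \<E> = pauli_map p)"

text \<open>
  \<open>extend_id \<E>\<close> is \<open>id \<otimes> \<E>\<close> for linear \<open>\<E>\<close>: it applies \<open>\<E>\<close> to each block of the operator
  with fixed row and column index on the first factor.
\<close>

definition extend_id :: "('n::finite op \<Rightarrow> 'n op) \<Rightarrow> ('m::finite \<times> 'n) op \<Rightarrow> ('m \<times> 'n) op" where
  "extend_id \<E> M = (\<chi> i j. \<E> (\<chi> k l. M $ (fst i, k) $ (fst j, l)) $ snd i $ snd j)"

definition choi :: "(qubit_op \<Rightarrow> qubit_op) \<Rightarrow> two_qubit_op" where
  "choi \<E> = extend_id \<E> (projector (bell_vec 0))"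

text \<open>\<open>p l k\<close> stands for the conditional probability of \<open>l\<close> given \<open>k\<close>.\<close>

definition classical_channel :: "(nat \<Rightarrow> nat \<Rightarrow> real) \<Rightarrow> bool" where
  "classical_channel p \<longleftrightarrow>
     (\<forall>k\<le>3. (\<forall>l\<le>3. 0 \<le> p l k) \<and> (\<Sum>l\<le>3. p l k) = 1)"

text \<open>
  The joint system is ordered as \<open>C, A, B\<close>, and the trace is over \<open>C\<close> and \<open>A\<close>.
\<close>

definition bob_unnormalized :: "two_qubit_op \<Rightarrow> nat \<Rightarrow> qubit_op \<Rightarrow> qubit_op" where
  "bob_unnormalized \<tau> k \<rho> =
     partial_trace_fst ((bell_proj k \<otimes>\<^sub>M mat 1) ** reassoc (\<rho> \<otimes>\<^sub>M \<tau>))"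

definition noisy_teleportation ::
    "two_qubit_op \<Rightarrow> (nat \<Rightarrow> nat \<Rightarrow> real) \<Rightarrow> qubit_op \<Rightarrow> qubit_op" where
  "noisy_teleportation \<tau> p \<rho> =
     (\<Sum>k\<le>3. \<Sum>l\<le>3. p l k *\<^sub>R (\<sigma> l ** bob_unnormalized \<tau> k \<rho> ** \<sigma> l))"

definition bloch_form ::
    "(nat \<Rightarrow> real) \<Rightarrow> (nat \<Rightarrow> real) \<Rightarrow> (nat \<Rightarrow> nat \<Rightarrow> real) \<Rightarrow> two_qubit_op" where
  "bloch_form a b t = (1 / 4) *\<^sub>R
     (mat 1 \<otimes>\<^sub>M mat 1
      + (\<Sum>i=1..3. a i *\<^sub>R (\<sigma> i \<otimes>\<^sub>M mat 1))
      + (\<Sum>j=1..3. b j *\<^sub>R (mat 1 \<otimes>\<^sub>M \<sigma> j))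
      + (\<Sum>i=1..3. \<Sum>j=1..3. t i j *\<^sub>R (\<sigma> i \<otimes>\<^sub>M \<sigma> j)))"

end

theory Submission
  imports Defs
begin

text \<open>
  Suppose \<open>\<tau>\<close> has \<open>b = 0\<close> and diagonal \<open>T\<close>. Its expectations \<open>w\<^sub>k\<close> in the Bell vectors do not involve
  \<open>a\<close>, so they form a probability distribution. Bell outcome \<open>k\<close> leaves Bob with one quarter of the
  Pauli map with weights \<open>w\<close> shifted by \<open>k\<close>, plus a multiple of the identity that depends on \<open>a\<close> and
  \<open>k\<close>. Bob's corrections shift the weights further and fix the multiples of the identity, which
  cancel in the sum over \<open>k\<close>. What remains is a convex combination of shifted Pauli channels.
  Up to phases, \<open>\<sigma>\<^sub>j \<sigma>\<^sub>k\<close> is \<open>\<sigma>\<close> at the bitwise exclusive or of \<open>j\<close> and \<open>k\<close>,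
  which is how the shifts are written.
\<close>

section \<open>Qubit indices and two-by-two matrices\<close>

unbundle bit_operations_syntax

text \<open>The library enumerates the type \<open>2\<close> as 1 and 2, the kets here are labelled
  0 and 1; arithmetic in this type is modulo two, so the labels agree.\<close>

lemma two_eq_0: "(2::2) = 0"
  using exhaust_2[of 0] by auto

lemma forall_qubit: "(\<forall>i::2. P i) \<longleftrightarrow> P 0 \<and> P 1"
  by (auto simp: forall_2 two_eq_0)

lemma sum_qubit: "sum f (UNIV::2 set) = f 0 + f 1"
  by (simp add: sum_2 two_eq_0 add.commute)

lemma sum_prod_UNIV:
  "sum f (UNIV::('a::finite \<times> 'b::finite) set) = (\<Sum>x\<in>UNIV. \<Sum>y\<in>UNIV. f (x, y))"
  by (simp add: sum.cartesian_product)

lemma sum_atMost_3: "(\<Sum>i\<le>(3::nat). f i) = f 0 + f 1 + f 2 + f 3"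
  by (simp add: numeral_eq_Suc)

lemma sum_1_3:
  "(\<Sum>i=1..(3::nat). f i) = f 1 + f 2 + f 3"
  "(\<Sum>i=Suc 0..3. f i) = f 1 + f 2 + f 3"
  by (simp_all add: numeral_eq_Suc)

lemma scaleR_complex: "r *\<^sub>R z = complex_of_real r * z"
  by (rule scaleR_conv_of_real)

lemma le_3_cases: "k \<le> (3::nat) \<Longrightarrow> k = 0 \<or> k = 1 \<or> k = 2 \<or> k = 3"
  by linarith

lemma mat2_nth [simp]:
  "mat2 p q r s $ 0 $ 0 = p" "mat2 p q r s $ 0 $ 1 = q"
  "mat2 p q r s $ 1 $ 0 = r" "mat2 p q r s $ 1 $ 1 = s"
  by (simp_all add: mat2_def)

lemma mat2_eta: "\<rho> = mat2 (\<rho> $ 0 $ 0) (\<rho> $ 0 $ 1) (\<rho> $ 1 $ 0) (\<rho> $ 1 $ 1)"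
  by (simp add: vec_eq_iff forall_qubit)

lemma mat2_algebra:
  "mat2 p q r s + mat2 p' q' r' s' = mat2 (p + p') (q + q') (r + r') (s + s')"
  "c *\<^sub>R mat2 p q r s = mat2 (c *\<^sub>R p) (c *\<^sub>R q) (c *\<^sub>R r) (c *\<^sub>R s)"
  "mat2 p q r s ** mat2 p' q' r' s' =
     mat2 (p * p' + q * r') (p * q' + q * s') (r * p' + s * r') (r * q' + s * s')"
  "mat z = mat2 z 0 0 z"
  by (simp_all add: vec_eq_iff forall_qubit matrix_matrix_mult_def sum_qubit mat_def)

lemma mat2_eq_iff:
  "mat2 p q r s = mat2 p' q' r' s' \<longleftrightarrow> p = p' \<and> q = q' \<and> r = r' \<and> s = s'"
  by (auto simp: vec_eq_iff forall_qubit)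

lemma pauli_simps:
  "\<sigma> 0 = mat2 1 0 0 1" "\<sigma> 1 = mat2 0 1 1 0" "\<sigma> (Suc 0) = mat2 0 1 1 0"
  "\<sigma> 2 = mat2 0 (- \<i>) \<i> 0" "\<sigma> 3 = mat2 1 0 0 (- 1)"
  by (simp_all add: pauli_def)

section \<open>Shifting the weights of Pauli maps\<close>

lemma xor_le_3: "j \<le> 3 \<Longrightarrow> k \<le> 3 \<Longrightarrow> j XOR k \<le> (3::nat)"
  by (auto dest!: le_3_cases)

text \<open>XOR with a fixed \<open>k\<close> permutes the indices 0 to 3, so shifted weights keep
  their total.\<close>

lemma sum_xor: "k \<le> 3 \<Longrightarrow> (\<Sum>j\<le>(3::nat). f (j XOR k)) = (\<Sum>j\<le>3. f j)"
  by (auto dest!: le_3_cases simp: sum_atMost_3 ac_simps)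

lemma pauli_map_mat2:
  "pauli_map p (mat2 a b c d) =
     mat2 ((p 0 + p 3) * a + (p 1 + p 2) * d) ((p 0 - p 3) * b + (p 1 - p 2) * c)
          ((p 1 - p 2) * b + (p 0 - p 3) * c) ((p 1 + p 2) * a + (p 0 + p 3) * d)"
  by (simp add: pauli_map_def sum_atMost_3 pauli_simps mat2_algebra mat2_eq_iff
      scaleR_complex algebra_simps)

lemma matrix_sandwich_affine:
  fixes A B C D :: "'n::finite op"
  shows "A ** (r *\<^sub>R B + C) ** D = r *\<^sub>R (A ** B ** D) + A ** C ** D"
  by (simp add: vec_eq_iff matrix_matrix_mult_def algebra_simps sum.distrib scaleR_sum_right
      scaleR_complex sum_distrib_left sum_distrib_right)

text \<open>The phase relating \<open>\<sigma> l ** \<sigma> j\<close> to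
  \<open>\<sigma> (j XOR l)\<close> cancels under conjugation; only a relabelling of the weights
  remains.\<close>

lemma pauli_conj_pauli_map:
  assumes "l \<le> 3"
  shows "\<sigma> l ** pauli_map p \<rho> ** \<sigma> l = pauli_map (\<lambda>j. p (j XOR l)) \<rho>"
proof -
  obtain a b c d where \<rho>: "\<rho> = mat2 a b c d" using mat2_eta by blast
  show ?thesis
    using le_3_cases[OF assms] unfolding \<rho> pauli_map_mat2
    by (elim disjE) (simp_all add: pauli_simps mat2_algebra mat2_eq_iff algebra_simps)
qed

lemma pauli_conj_mat:
  assumes "l \<le> 3"
  shows "\<sigma> l ** mat c ** \<sigma> l = mat c"
  using le_3_cases[OF assms]
  by (elim disjE) (simp_all add: pauli_simps mat2_algebra mult.assoc mult.left_commute[of \<i>])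

section \<open>Bell states and Bloch forms\<close>

text \<open>The coefficient \<open>t\<^sub>i\<^sub>i\<close> (of \<open>\<sigma>\<^sub>i \<otimes> \<sigma>\<^sub>i / 4\<close>) in the Bloch form of the \<open>k\<close>-th Bell projector.\<close>

definition bell_corr :: "nat \<Rightarrow> nat \<Rightarrow> real" where
  "bell_corr k i = (if i = 2 then - 1 else 1) * (if k = 0 \<or> k = i then 1 else - 1)"

definition bell_weight :: "(nat \<Rightarrow> nat \<Rightarrow> real) \<Rightarrow> nat \<Rightarrow> real" where
  "bell_weight t k = (1 + (\<Sum>i=1..3. bell_corr k i * t i i)) / 4"

lemma bell_vec_nth:
  "bell_vec 0 $ (x, y) = (if x = y then 1 / sqrt 2 else 0)"
  "bell_vec 1 $ (x, y) = (if x = y then 0 else 1 / sqrt 2)"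
  "bell_vec (Suc 0) $ (x, y) = (if x = y then 0 else 1 / sqrt 2)"
  "bell_vec 2 $ (x, y) = (if x = y then 0 else if x = 0 then 1 / sqrt 2 else - (1 / sqrt 2))"
  "bell_vec 3 $ (x, y) = (if x = y then if x = 0 then 1 / sqrt 2 else - (1 / sqrt 2) else 0)"
  using exhaust_2[of x] exhaust_2[of y]
  by (auto simp: bell_vec_def ket2_def axis_def scaleR_complex)

lemma bell_proj_nth:
  "bell_proj 0 $ (x, y) $ (x', y') = (if x = y \<and> x' = y' then 1 / 2 else 0)"
  "bell_proj 1 $ (x, y) $ (x', y') = (if x \<noteq> y \<and> x' \<noteq> y' then 1 / 2 else 0)"
  "bell_proj (Suc 0) $ (x, y) $ (x', y') = (if x \<noteq> y \<and> x' \<noteq> y' then 1 / 2 else 0)"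
  "bell_proj 2 $ (x, y) $ (x', y') =
     (if x \<noteq> y \<and> x' \<noteq> y' then if x = x' then 1 / 2 else - (1 / 2) else 0)"
  "bell_proj 3 $ (x, y) $ (x', y') =
     (if x = y \<and> x' = y' then if x = x' then 1 / 2 else - (1 / 2) else 0)"
proof -
  have s: "complex_of_real (sqrt 2) * complex_of_real (sqrt 2) = 2"
    by (simp flip: of_real_mult)
  then have s': "2 / complex_of_real (sqrt 2) = complex_of_real (sqrt 2)"
    by (simp add: field_simps)
  note [simp] = bell_proj_def projector_def bell_vec_nth s s'
  note cases = exhaust_2[of x] exhaust_2[of y] exhaust_2[of x'] exhaust_2[of y']
  show "bell_proj 0 $ (x, y) $ (x', y') = (if x = y \<and> x' = y' then 1 / 2 else 0)"
    "bell_proj 1 $ (x, y) $ (x', y') = (if x \<noteq> y \<and> x' \<noteq> y' then 1 / 2 else 0)"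
    "bell_proj (Suc 0) $ (x, y) $ (x', y') = (if x \<noteq> y \<and> x' \<noteq> y' then 1 / 2 else 0)"
    "bell_proj 2 $ (x, y) $ (x', y') =
       (if x \<noteq> y \<and> x' \<noteq> y' then if x = x' then 1 / 2 else - (1 / 2) else 0)"
    "bell_proj 3 $ (x, y) $ (x', y') =
       (if x = y \<and> x' = y' then if x = x' then 1 / 2 else - (1 / 2) else 0)"
    using cases by auto
qed

lemma bob_unnormalized_nth:
  "bob_unnormalized \<tau> k \<rho> $ i $ j =
     (\<Sum>c\<in>UNIV. \<Sum>a\<in>UNIV. \<Sum>c'\<in>UNIV. \<Sum>a'\<in>UNIV.
        bell_proj k $ (c, a) $ (c', a') * (\<rho> $ c' $ c * \<tau> $ (a', i) $ (a, j)))"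
  unfolding bob_unnormalized_def partial_trace_fst_def matrix_matrix_mult_def reassoc_def
    tensor_def mat_def
  by (simp add: sum_prod_UNIV mult.assoc if_distrib[of "\<lambda>x. x * _"]
      if_distrib[of "\<lambda>x. _ * x"] cong: if_cong)

lemma bloch_form_nth:
  "bloch_form a b t $ (x, i) $ (y, j) = (1 / 4) * (mat 1 $ x $ y * mat 1 $ i $ j
      + (\<Sum>m=1..3. a m * (\<sigma> m $ x $ y * mat 1 $ i $ j))
      + (\<Sum>n=1..3. b n * (mat 1 $ x $ y * \<sigma> n $ i $ j))
      + (\<Sum>m=1..3. \<Sum>n=1..3. t m n * (\<sigma> m $ x $ y * \<sigma> n $ i $ j)))"
  by (simp add: bloch_form_def tensor_def scaleR_complex)

text \<open>A Bell projector has no local Bloch terms and a diagonal correlation matrix. Trace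
  orthogonality of products of Pauli matrices therefore leaves only the constant and the
  \<open>t i i\<close>.\<close>

lemma quad_form_bell_vec:
  assumes "k \<le> 3"
  shows "quad_form (bloch_form a b t) (bell_vec k) = bell_weight t k"
proof -
  have s: "complex_of_real (sqrt 2) * complex_of_real (sqrt 2) = 2"
    by (simp flip: of_real_mult)
  have s': "complex_of_real (sqrt 2) * (complex_of_real (sqrt 2) * x) = 2 * x" for x
    by (simp add: s flip: mult.assoc)
  show ?thesis
    using le_3_cases[OF assms]
    by (elim disjE) (simp_all add: quad_form_def matrix_vector_mult_def sum_prod_UNIV sum_qubit
        bell_vec_nth bloch_form_nth sum_1_3 pauli_simps mat2_algebra bell_weight_def bell_corr_def
        field_simps s s')
qed

text \<open>Expanding the Bell projector in Pauli products, the trace over CA pairs the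
  \<open>\<sigma> i\<close> component of the input with that of A. The \<open>t i i\<close> terms
  rescale the Bloch components, giving the Pauli map; the \<open>a i\<close> terms carry the
  identity on B. Their factor 1/8 is 1/4 from each Bloch form times the trace 2 of a squared Pauli
  matrix.\<close>

lemma bob_unnormalized_bloch_form:
  assumes "k \<le> 3"
    and "\<forall>j\<in>{1..3}. b j = 0"
    and "\<forall>i\<in>{1..3}. \<forall>j\<in>{1..3}. i \<noteq> j \<longrightarrow> t i j = 0"
  shows "bob_unnormalized (bloch_form a b t) k \<rho> =
    (1 / 4) *\<^sub>R pauli_map (\<lambda>j. bell_weight t (j XOR k)) \<rho>
      + mat ((\<Sum>i=1..3. bell_corr k i * a i * trace (\<sigma> i ** \<rho>)) / 8)"
proof -
  obtain p q r s where \<rho>: "\<rho> = mat2 p q r s" using mat2_eta by blast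
  have z: "b 1 = 0" "b 2 = 0" "b 3 = 0" "t 1 2 = 0" "t 1 3 = 0" "t 2 1 = 0" "t 2 3 = 0"
    "t 3 1 = 0" "t 3 2 = 0"
    using assms(2,3) by auto
  show ?thesis
    using le_3_cases[OF assms(1)]
    by (elim disjE)
      (simp_all add: z z[simplified] \<rho> vec_eq_iff forall_qubit pauli_map_mat2 mat2_algebra
        bob_unnormalized_nth sum_qubit bell_proj_nth bloch_form_nth sum_1_3 pauli_simps trace_def
        bell_weight_def bell_corr_def scaleR_complex field_simps)
qed

section \<open>Noisy teleportation as a Pauli map\<close>

lemma noisy_teleportation_bloch_form:
  assumes "classical_channel p"
    and "\<forall>j\<in>{1..3}. b j = 0"
    and "\<forall>i\<in>{1..3}. \<forall>j\<in>{1..3}. i \<noteq> j \<longrightarrow> t i j = 0"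
  shows "noisy_teleportation (bloch_form a b t) p =
    pauli_map (\<lambda>j. (\<Sum>k\<le>3. \<Sum>l\<le>3. p l k * bell_weight t (j XOR l XOR k)) / 4)"
proof
  fix \<rho>
  define c where "c k = (\<Sum>i=1..3. bell_corr k i * a i * trace (\<sigma> i ** \<rho>)) / 8" for k
  define w where "w k l j = bell_weight t (j XOR l XOR k)" for k l j
  \<comment> \<open>For each fixed \<open>i\<close>, \<open>bell_corr k i\<close> is +1 for two
    outcomes \<open>k\<close> and -1 for the other two.\<close>
  have c_sum: "(\<Sum>k\<le>3. c k) = 0"
    by (simp add: c_def sum_atMost_3 sum_1_3 bell_corr_def field_simps)
  have summand: "p l k *\<^sub>R (\<sigma> l ** bob_unnormalized (bloch_form a b t) k \<rho> ** \<sigma> l) =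
      (p l k / 4) *\<^sub>R pauli_map (w k l) \<rho> + p l k *\<^sub>R mat (c k)"
    if "k \<le> 3" "l \<le> 3" for k l
    unfolding bob_unnormalized_bloch_form[OF that(1) assms(2,3)] c_def[symmetric] using that
    by (simp add: matrix_sandwich_affine pauli_conj_mat pauli_conj_pauli_map w_def[abs_def]
        scaleR_right_distrib xor.assoc)
  have norm: "(\<Sum>l\<le>3. p l k) = 1" if "k \<le> 3" for k
    using assms(1) that by (simp add: classical_channel_def)
  \<comment> \<open>\<open>pauli_map\<close> is linear in its weights, so the Pauli sum can be
    exchanged with the sums over \<open>k\<close> and \<open>l\<close>.\<close>
  have lin: "pauli_map (\<lambda>j. (\<Sum>k\<le>3. \<Sum>l\<le>3. p l k * w k l j) / 4) \<rho> =
      (\<Sum>k\<le>3. \<Sum>l\<le>3. (p l k / 4) *\<^sub>R pauli_map (w k l) \<rho>)"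
    unfolding pauli_map_def scaleR_sum_right scaleR_sum_left sum_divide_distrib
    by (subst sum.swap, rule sum.cong[OF refl], subst sum.swap) simp
  have zero: "(\<Sum>k\<le>3. \<Sum>l\<le>3. p l k *\<^sub>R mat (c k)) = (0::qubit_op)"
  proof -
    \<comment> \<open>The identity part does not depend on \<open>l\<close>, so the conditional
      probabilities sum out to 1.\<close>
    have "(\<Sum>k\<le>3. \<Sum>l\<le>3. p l k *\<^sub>R mat (c k)) = (\<Sum>k\<le>3. mat (c k) :: qubit_op)"
      by (simp add: norm flip: scaleR_sum_left)
    also have "\<dots> = mat (\<Sum>k\<le>3. c k)"
      by (simp add: sum_atMost_3 mat2_algebra)
    finally show ?thesis by (simp add: c_sum mat2_algebra vec_eq_iff forall_qubit)
  qed
  have "noisy_teleportation (bloch_form a b t) p \<rho> =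
      (\<Sum>k\<le>3. \<Sum>l\<le>3. (p l k / 4) *\<^sub>R pauli_map (w k l) \<rho> + p l k *\<^sub>R mat (c k))"
    unfolding noisy_teleportation_def by (intro sum.cong refl summand) auto
  also have "\<dots> = pauli_map (\<lambda>j. (\<Sum>k\<le>3. \<Sum>l\<le>3. p l k * w k l j) / 4) \<rho>"
    by (simp only: sum.distrib zero lin add_0_right)
  finally show "noisy_teleportation (bloch_form a b t) p \<rho> =
      pauli_map (\<lambda>j. (\<Sum>k\<le>3. \<Sum>l\<le>3. p l k * bell_weight t (j XOR l XOR k)) / 4) \<rho>"
    by (simp only: w_def)
qed

section \<open>The weights as a probability distribution\<close>

lemma bell_weight_nonneg:
  assumes "density_operator (bloch_form a b t)" "k \<le> 3"
  shows "0 \<le> bell_weight t k"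
  \<comment> \<open>Positivity of the state is tested on the Bell vector.\<close>
  using assms(1) quad_form_bell_vec[OF assms(2), of a b t]
  unfolding density_operator_def by (metis Re_complex_of_real)

lemma sum_bell_weight: "(\<Sum>k\<le>3. bell_weight t k) = 1"
  by (simp add: bell_weight_def sum_atMost_3 sum_1_3 bell_corr_def field_simps)

lemma pauli_channel_noisy_teleportation:
  assumes "density_operator (bloch_form a b t)" "classical_channel p"
    and "\<forall>j\<in>{1..3}. b j = 0"
    and "\<forall>i\<in>{1..3}. \<forall>j\<in>{1..3}. i \<noteq> j \<longrightarrow> t i j = 0"
  shows "pauli_channel (noisy_teleportation (bloch_form a b t) p)"
proof -
  define r where "r j = (\<Sum>k\<le>3. \<Sum>l\<le>3. p l k * bell_weight t (j XOR l XOR k)) / 4" for j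
  have "0 \<le> r j" if "j \<le> 3" for j
    unfolding r_def
    using assms(2) that
    by (auto intro!: divide_nonneg_nonneg sum_nonneg mult_nonneg_nonneg
        bell_weight_nonneg[OF assms(1)] xor_le_3 simp: classical_channel_def)
  moreover have "(\<Sum>j\<le>3. r j) = 1"
  proof -
    have "(\<Sum>j\<le>3. r j) = (\<Sum>k\<le>3. \<Sum>l\<le>3. p l k * (\<Sum>j\<le>3. bell_weight t (j XOR l XOR k))) / 4"
      unfolding r_def sum_divide_distrib[symmetric] sum_distrib_left
      by (subst sum.swap) (intro arg_cong[of _ _ "\<lambda>x. x / 4"] sum.cong refl sum.swap)
    \<comment> \<open>The combined shift \<open>l XOR k\<close> is again at most 3, so each inner
      sum over \<open>j\<close> equals 1. The four outcomes then contribute 4 in total, which the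
      division by 4 normalizes.\<close>
    also have "\<dots> = (\<Sum>k\<le>(3::nat). \<Sum>l\<le>3. p l k) / 4"
      by (simp add: sum_xor[where f="bell_weight t"] xor_le_3 sum_bell_weight)
    also have "\<dots> = 1"
      using assms(2) by (simp add: classical_channel_def)
    finally show ?thesis .
  qed
  ultimately show ?thesis
    unfolding pauli_channel_def
    using noisy_teleportation_bloch_form[OF assms(2-4), where a=a, folded r_def] by auto
qed

section \<open>Choi matrices of Pauli channels\<close>

lemma choi_nth:
  "choi \<E> $ (x, i) $ (y, j) =
     \<E> (mat2 (bell_proj 0 $ (x, 0) $ (y, 0)) (bell_proj 0 $ (x, 0) $ (y, 1))
             (bell_proj 0 $ (x, 1) $ (y, 0)) (bell_proj 0 $ (x, 1) $ (y, 1))) $ i $ j"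
proof -
  have "(\<chi> k l. bell_proj 0 $ (x, k) $ (y, l)) =
    mat2 (bell_proj 0 $ (x, 0) $ (y, 0)) (bell_proj 0 $ (x, 0) $ (y, 1))
             (bell_proj 0 $ (x, 1) $ (y, 0)) (bell_proj 0 $ (x, 1) $ (y, 1))"
    by (simp add: vec_eq_iff forall_qubit)
  then show ?thesis
    by (simp add: choi_def extend_id_def flip: bell_proj_def)
qed

text \<open>Applying \<open>\<sigma> i\<close> to one half of \<open>bell_vec 0\<close> gives
  \<open>bell_vec i\<close> up to phase. The Choi matrix is thus a combination of Bell projectors,
  which have neither local terms nor off-diagonal correlations.\<close>

lemma bloch_form_eq_choi_pauli_map:
  assumes "bloch_form a b t = choi (pauli_map q)"
  shows "\<forall>j\<in>{1..3}. b j = 0"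
    and "\<forall>i\<in>{1..3}. \<forall>j\<in>{1..3}. i \<noteq> j \<longrightarrow> t i j = 0"
proof -
  have eq: "bloch_form a b t $ (x, i) $ (y, j) = choi (pauli_map q) $ (x, i) $ (y, j)" for x y i j
    by (simp add: assms)
  \<comment> \<open>All sixteen entries; their real and imaginary parts are linear equations in the
    real Bloch coefficients and the weights \<open>q\<close>.\<close>
  note eqs = eq[of 0 0 0 0] eq[of 0 0 0 1] eq[of 0 1 0 0] eq[of 0 1 0 1]
    eq[of 0 0 1 0] eq[of 0 0 1 1] eq[of 0 1 1 0] eq[of 0 1 1 1]
    eq[of 1 0 0 0] eq[of 1 0 0 1] eq[of 1 1 0 0] eq[of 1 1 0 1]
    eq[of 1 0 1 0] eq[of 1 0 1 1] eq[of 1 1 1 0] eq[of 1 1 1 1]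
  have "b 1 = 0 \<and> b 2 = 0 \<and> b 3 = 0 \<and>
      t 1 2 = 0 \<and> t 1 3 = 0 \<and> t 2 1 = 0 \<and> t 2 3 = 0 \<and> t 3 1 = 0 \<and> t 3 2 = 0"
    using eqs
    by (simp add: bloch_form_nth choi_nth bell_proj_nth pauli_map_mat2 sum_1_3 pauli_simps
        mat2_algebra complex_eq_iff)
  then show "\<forall>j\<in>{1..3}. b j = 0"
    and "\<forall>i\<in>{1..3}. \<forall>j\<in>{1..3}. i \<noteq> j \<longrightarrow> t i j = 0"
    by (auto simp: atLeastAtMost_iff Suc_le_eq dest!: le_3_cases)
qed

theorem corollary13:
  fixes \<tau> :: two_qubit_op
    and a b :: "nat \<Rightarrow> real"
    and t :: "nat \<Rightarrow> nat \<Rightarrow> real"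
  assumes "density_operator \<tau>"
    and "\<tau> = bloch_form a b t"
    and "\<exists>p. classical_channel p \<and> \<not> pauli_channel (noisy_teleportation \<tau> p)"
  shows "((\<exists>j\<in>{1..3}. b j \<noteq> 0) \<or> (\<exists>i\<in>{1..3}. \<exists>j\<in>{1..3}. i \<noteq> j \<and> t i j \<noteq> 0)) \<and>
         \<not> (\<exists>\<E>. pauli_channel \<E> \<and> \<tau> = choi \<E>)"
proof -
  have "(\<exists>j\<in>{1..3}. b j \<noteq> 0) \<or> (\<exists>i\<in>{1..3}. \<exists>j\<in>{1..3}. i \<noteq> j \<and> t i j \<noteq> 0)"
    using pauli_channel_noisy_teleportation[of a b t] assms by blast
  moreover have "\<not> (\<exists>\<E>. pauli_channel \<E> \<and> \<tau> = choi \<E>)"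
  proof
    assume "\<exists>\<E>. pauli_channel \<E> \<and> \<tau> = choi \<E>"
    then obtain q where "bloch_form a b t = choi (pauli_map q)"
      using assms(2) by (auto simp: pauli_channel_def)
    \<comment> \<open>\<open>calculation\<close> still holds the disjunction proved first, which the
      Choi form contradicts.\<close>
    from bloch_form_eq_choi_pauli_map[OF this] calculation show False by blast
  qed
  ultimately show ?thesis ..
qed

end
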